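(* Let $\{D_i\}_{i\ge 1}$ be a set of (finite, loopless) digraphs such that $|V(D_i)| = i$ for each $i$ and such that the undirected graph underlying $D_i$ is connected for each $i$. Let $\mathbf{X}_{D_i}\in\mathsf{NSym}$ denote the chromatic noncommutative symmetric function of $D_i$. Then $$\mathsf{NSym} = \mathbb{k}\langle \mathbf{X}_{D_1}, \mathbf{X}_{D_2},\ldots\rangle,$$ that is, $\mathsf{NSym}$ is generated as a $\mathbb{k}$-algebra by the elements $\mathbf{X}_{D_i}$, $i \geq 1$, and the elements of $\{\mathbf{X}_{D_i}\}_{i\ge1}$ are algebraically independent over $\mathbb{k}$ (in the noncommutative sense: no nonzero polynomial over $\mathbb{k}$ in noncommuting variables vanishes on them).
   Context: Fix a field $\mathbb{k}$ of characteristic $0$. **NSym.** $\mathsf{NSym} = \mathbb{k}\langle H_1,H_2,\ldots\rangle$ is the free associative unital $\mathbb{k}$-algebra on noncommuting generators $H_n$ with $\deg H_n = n$. A composition is a finite tuple $\alpha = (\alpha_1,\ldots,\alpha_{\ell(\alpha)})$ of positive integers; $H_\alpha = H_{\alpha_1}\cdots H_{\alpha_{\ell(\alpha)}}$, $H_{()}=1$. For compositions $\alpha,\beta$ of the same integer, write $\beta \ge \alpha$ if $D(\beta) \subseteq D(\alpha)$, where $D(c) = \{c_1, c_1+c_2, \ldots, c_1+\cdots+c_{\ell(c)-1}\}$. The ribbon elements are $R_\alpha = \sum_{\beta\ge\alpha} (-1)^{\ell(\alpha)-\ell(\beta)} H_\beta$. Define $\Psi_n = \sum_{i=0}^{n-1}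 (-1)^i R_{(1^i,\,n-i)}$ for $n \ge 1$, where $(1^i, n-i)$ is the composition consisting of $i$ ones followed by $n-i$, and $\Psi_\alpha = \Psi_{\alpha_1}\Psi_{\alpha_2}\cdots\Psi_{\alpha_{\ell(\alpha)}}$, $\Psi_{()}=1$. **Digraphs.** A digraph $D=(V(D),E(D))$ consists of a finite set $V(D)$ and a set $E(D)$ of ordered pairs (arcs) of elements of $V(D)$, with no loops. Its underlying undirected graph $G$ has vertex set $V(D)$ and edge set $\{\{u,v\} : (u,v)\in E(D)\}$. For a vertex $w$, the outdegree $\mathrm{od}\,w$ is the number of $v$ with $(w,v)\in E(D)$, and the indegree $\mathrm{id}\,w$ is the number of $v$ with $(v,w)\in E(D)$. For $W\subseteq V(D)$, the total degree (computed in all of $D$) is $\mathrm{td}\,W = \sum_{w\in W}\mathrm{od}\,w - \sum_{w\in W}\mathrm{id}\,w$. **The composition $\alpha(S)$.** Let $S\subseteq E(D)$ and $S' = \{\{u,v\} : (u,v)\in S\}\subseteq E(G)$. Consider the vertex sets of the connected components of the spanning subgraph $(V(D),S')$ of $G$. Fix a labeling (total order) $v_1<v_2<\cdots<v_{|V|}$ of $V = V(D)$. For two distinct components $C,C'$ put $C\rhd C'$ if: (1) $\mathrm{td}\,C>\mathrm{td}\,C'$; or (2) $\mathrm{td}\,C=\mathrm{td}\,C'$ and $|C|>|C'|$; or (3) $\mathrm{td}\,C=\mathrm{td}\,C'$, $|C|=|C'|$, and $C$ is lexicographically strictly greater than $C'$, where a vertex subset is identified with the word of its vertex indices written in increasing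 order. Then $\alpha(S)$ is the composition of $|V|$ listing the sizes of the components in the order given by $\rhd$, with $\rhd$-greatest component first (so components of larger total degree come first). The composition $\alpha(S)$ does not depend on the chosen labeling. **Chromatic noncommutative symmetric function.** $$\mathbf{X}_D = \sum_{S\subseteq E(D)} (-1)^{|S|}\,\Psi_{\alpha(S)} \in \mathsf{NSym}.$$ *)

theory Defs
  imports Complex_Main "HOL-Library.Poly_Mapping" "Graph_Theory.Graph_Theory"
begin

section \<open>Free associative algebras\<close>

text \<open>
  The free monoid is a type of its own so that it can be made an (additively written) instance
  of \<^class>\<open>monoid_add\<close>. The library's convolution product on \<^typ>\<open>'w \<Rightarrow>\<^sub>0 'k\<close> is
  then the product of the monoid algebra of the free monoid, i.e. the concatenation product of
  noncommutative polynomials.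
\<close>

datatype 'a free_monoid = Word (letters: "'a list")

instantiation free_monoid :: (type) monoid_add
begin

definition zero_free_monoid :: "'a free_monoid" where
  "0 = Word []"

definition plus_free_monoid :: "'a free_monoid \<Rightarrow> 'a free_monoid \<Rightarrow> 'a free_monoid" where
  "u + v = Word (letters u @ letters v)"

instance
  by standard (simp_all add: zero_free_monoid_def plus_free_monoid_def)

end

type_synonym ('a, 'k) ncpoly = "'a free_monoid \<Rightarrow>\<^sub>0 'k"

definition nc_const :: "'k::field \<Rightarrow> ('a, 'k) ncpoly" where
  "nc_const c = Poly_Mapping.single 0 c"

definition nc_var :: "'a \<Rightarrow> ('a, 'k::field) ncpoly" where
  "nc_var a = Poly_Mapping.single (Word [a]) 1"

definition free_algebra :: "'a set \<Rightarrow> ('a, 'k::field) ncpoly set" where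
  "free_algebra I = {p. \<forall>w\<in>Poly_Mapping.keys p. set (letters w) \<subseteq> I}"

definition nc_subalgebra :: "('a, 'k::field) ncpoly set \<Rightarrow> bool" where
  "nc_subalgebra A \<longleftrightarrow> 1 \<in> A \<and> (\<forall>c. \<forall>a\<in>A. nc_const c * a \<in> A) \<and>
     (\<forall>a\<in>A. \<forall>b\<in>A. a + b \<in> A \<and> a * b \<in> A)"

text \<open>Evaluation of a polynomial in noncommuting variables \<open>i\<close> at elements \<open>x i\<close> of a free algebra.\<close>

definition nc_eval :: "('i \<Rightarrow> ('a, 'k::field) ncpoly) \<Rightarrow> ('i, 'k) ncpoly \<Rightarrow> ('a, 'k) ncpoly" where
  "nc_eval x p = (\<Sum>w\<in>Poly_Mapping.keys p.
     nc_const (Poly_Mapping.lookup p w) * prod_list (map x (letters w)))"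

definition nc_independent :: "'i set \<Rightarrow> ('i \<Rightarrow> ('a, 'k::field) ncpoly) \<Rightarrow> bool" where
  "nc_independent I x \<longleftrightarrow> (\<forall>p\<in>free_algebra I. nc_eval x p = 0 \<longrightarrow> p = 0)"


section \<open>Noncommutative symmetric functions\<close>

type_synonym 'k nsym = "(nat, 'k) ncpoly"

text \<open>
  The letter \<open>n \<ge> 1\<close> stands for the generator \<open>H\<^sub>n\<close>; the letter \<open>0\<close> of the ambient type is not used,
  so that NSym is a proper subset of the type \<^typ>\<open>'k nsym\<close>.
\<close>

definition NSym :: "'k::field nsym set" where
  "NSym = free_algebra {1..}"

definition is_composition :: "nat list \<Rightarrow> bool" where
  "is_composition \<alpha> \<longleftrightarrow> (\<forall>a\<in>set \<alpha>. a \<ge> 1)"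

definition descent_set :: "nat list \<Rightarrow> nat set" where
  "descent_set \<alpha> = (\<lambda>k. sum_list (take k \<alpha>)) ` {1..<length \<alpha>}"

definition coarsenings :: "nat list \<Rightarrow> nat list set" where
  "coarsenings \<alpha> =
     {\<beta>. is_composition \<beta> \<and> sum_list \<beta> = sum_list \<alpha> \<and> descent_set \<beta> \<subseteq> descent_set \<alpha>}"

lemma length_le_sum_list_composition: "is_composition \<alpha> \<Longrightarrow> length \<alpha> \<le> sum_list \<alpha>"
  by (induction \<alpha>) (auto simp: is_composition_def)

lemma finite_coarsenings: "finite (coarsenings \<alpha>)"
proof (rule finite_subset)
  show "coarsenings \<alpha> \<subseteq> {\<beta>. set \<beta> \<subseteq> {..sum_list \<alpha>} \<and> length \<beta> \<le> sum_list \<alpha>}"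
    by (auto simp: coarsenings_def dest: length_le_sum_list_composition member_le_sum_list)
  show "finite {\<beta>. set \<beta> \<subseteq> {..sum_list \<alpha>} \<and> length \<beta> \<le> sum_list \<alpha>}"
    by (rule finite_lists_length_le) simp
qed

definition nsym_H :: "nat list \<Rightarrow> 'k::field nsym" where
  "nsym_H \<alpha> = prod_list (map nc_var \<alpha>)"

text \<open>
  The subtraction in the exponent does not truncate, since a coarsening of a composition \<open>\<alpha>\<close>
  is at most as long as \<open>\<alpha>\<close>.
\<close>

definition nsym_R :: "nat list \<Rightarrow> 'k::field nsym" where
  "nsym_R \<alpha> = (\<Sum>\<beta>\<in>coarsenings \<alpha>. (- 1) ^ (length \<alpha> - length \<beta>) * nsym_H \<beta>)"

definition nsym_Psi :: "nat \<Rightarrow> 'k::field nsym" where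
  "nsym_Psi n = (\<Sum>i<n. (- 1) ^ i * nsym_R (replicate i 1 @ [n - i]))"

definition nsym_Psi_comp :: "nat list \<Rightarrow> 'k::field nsym" where
  "nsym_Psi_comp \<alpha> = prod_list (map nsym_Psi \<alpha>)"


section \<open>The chromatic noncommutative symmetric function of a digraph\<close>

definition total_degree :: "'v pair_pre_digraph \<Rightarrow> 'v set \<Rightarrow> int" where
  "total_degree D W =
     (\<Sum>w\<in>W. int (out_degree (with_proj D) w)) - (\<Sum>w\<in>W. int (in_degree (with_proj D) w))"

text \<open>
  An undirected graph is represented by its symmetric digraph; its connected components are the
  strongly connected components of the latter.
\<close>

definition conn_components :: "'v pair_pre_digraph \<Rightarrow> ('v \<times> 'v) set \<Rightarrow> 'v set set" where
  "conn_components D S = pre_digraph.sccs_verts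
     (with_proj (mk_symmetric (with_proj \<lparr>pverts = pverts D, parcs = S\<rparr>)))"

text \<open>
  A labeling \<open>v\<^sub>1 < v\<^sub>2 < \<dots>\<close> of the vertices is given by the function \<open>lab\<close> taking \<open>v\<^sub>j\<close> to its
  index \<open>j\<close>.
\<close>

definition index_word :: "('v \<Rightarrow> nat) \<Rightarrow> 'v set \<Rightarrow> nat list" where
  "index_word lab C = sorted_list_of_set (lab ` C)"

definition comp_greater :: "('v \<Rightarrow> nat) \<Rightarrow> 'v pair_pre_digraph \<Rightarrow> 'v set \<Rightarrow> 'v set \<Rightarrow> bool" where
  "comp_greater lab D C C' \<longleftrightarrow>
     total_degree D C > total_degree D C' \<or>
     total_degree D C = total_degree D C' \<and> card C > card C' \<or>
     total_degree D C = total_degree D C' \<and> card C = card C' \<and>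
       (index_word lab C', index_word lab C) \<in> lexord less_than"

lemma sorted_wrt_list_ex:
  assumes "finite A" "\<And>x y z. x\<in>A \<Longrightarrow> y\<in>A \<Longrightarrow> z\<in>A \<Longrightarrow> P x y \<Longrightarrow> P y z \<Longrightarrow> P x z"
   "\<And>x y. x\<in>A \<Longrightarrow> y\<in>A \<Longrightarrow> x \<noteq> y \<Longrightarrow> P x y \<or> P y x"
  shows "\<exists>xs. set xs = A \<and> distinct xs \<and> sorted_wrt P xs"
  using assms
proof (induction A rule: finite_induct)
  case empty then show ?case by simp
next
  case (insert a A)
  have "\<exists>xs. set xs = A \<and> distinct xs \<and> sorted_wrt P xs"
  proof (rule insert.IH)
    show "P x z" if "x \<in> A" "y \<in> A" "z \<in> A" "P x y" "P y z" for x y z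
      using insert.prems(1)[of x y z] that by simp
    show "P x y \<or> P y x" if "x \<in> A" "y \<in> A" "x \<noteq> y" for x y
      using insert.prems(2)[of x y] that by simp
  qed
  then obtain xs where xs: "set xs = A" "distinct xs" "sorted_wrt P xs"
    by blast
  let ?l = "filter (\<lambda>x. P x a) xs" and ?r = "filter (\<lambda>x. \<not> P x a) xs"
  have "set (?l @ a # ?r) = insert a A" using xs by auto
  moreover have "distinct (?l @ a # ?r)"
    using xs insert.hyps by auto
  moreover have "sorted_wrt P (?l @ a # ?r)"
  proof -
    have split: "sorted_wrt P (l @ a # r)"
      if "sorted_wrt P l" "sorted_wrt P r" "\<forall>x\<in>set l. P x a" "\<forall>y\<in>set r. P a y"
        "\<forall>x\<in>set l. \<forall>y\<in>set r. P x y" for l r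
      using that by (simp add: sorted_wrt_append)
    have r: "P a y" if "y \<in> set ?r" for y
      using insert.prems(2)[of a y] that xs insert.hyps by auto
    have lr: "P x y" if "x \<in> set ?l" "y \<in> set ?r" for x y
      using insert.prems(1)[of x a y] r[OF that(2)] that xs(1) by simp
    have l: "\<forall>x\<in>set ?l. P x a" by simp
    show ?thesis
      by (intro split[OF sorted_wrt_filter[OF xs(3)] sorted_wrt_filter[OF xs(3)] l] ballI)
        (erule r, erule (1) lr)
  qed
  ultimately show ?case by blast
qed

lemma sorted_wrt_list_unique:
  assumes "\<And>x y. P x y \<Longrightarrow> \<not> P y x"
  shows "set xs = set ys \<Longrightarrow> distinct xs \<Longrightarrow> distinct ys \<Longrightarrow> sorted_wrt P xs \<Longrightarrow> sorted_wrt P ys \<Longrightarrow> xs = ys"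
proof (induction xs arbitrary: ys)
  case (Cons x xs)
  then obtain y zs where ys: "ys = y # zs" by (cases ys) auto
  have "x = y" using Cons.prems assms unfolding ys by (metis list.set_intros(1) set_ConsD sorted_wrt.simps(2))
  moreover have "xs = zs" using Cons.prems Cons.IH[of zs] \<open>x = y\<close> unfolding ys by (auto simp: insert_ident)
  ultimately show ?case using ys by simp
qed simp

lemma conn_components_subset: assumes "C \<in> conn_components D S" shows "C \<subseteq> pverts D \<and> C \<noteq> {}"
proof -
  let ?G = "with_proj (mk_symmetric (with_proj \<lparr>pverts = pverts D, parcs = S\<rparr>))"
  have "u \<in> pverts D" if "u \<in> C" for u
  proof -
    have "reachable ?G u u" using assms that by (auto simp: conn_components_def pre_digraph.sccs_verts_def)
    then show ?thesis unfolding reachable_def by (cases rule: rtrancl_on.cases) (auto simp: mk_symmetric_def)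
  qed
  then show ?thesis using assms by (auto simp: conn_components_def pre_digraph.sccs_verts_def)
qed

lemma lexord_less_than_total: "u \<noteq> v \<Longrightarrow> (u,v) \<in> lexord less_than \<or> (v,u) \<in> lexord less_than"
  using lexord_linear[of less_than u v] by (metis less_than_iff nat_neq_iff)

lemma lexord_less_than_trans: "(u,v) \<in> lexord less_than \<Longrightarrow> (v,w) \<in> lexord less_than \<Longrightarrow> (u,w) \<in> lexord less_than"
  by (rule lexord_trans) simp_all

lemma lexord_less_than_asym: "(u,v) \<in> lexord less_than \<Longrightarrow> (v,u) \<notin> lexord less_than"
  using lexord_less_than_trans[of u v u] lexord_irreflexive[of less_than u] by auto

lemma comp_list_ex1:
  assumes "finite (pverts D)" "inj_on lab (pverts D)"
  shows "\<exists>!Cs. set Cs = conn_components D S \<and> distinct Cs \<and> sorted_wrt (comp_greater lab D) Cs"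
proof (rule ex_ex1I)
  have w: "index_word lab C \<noteq> index_word lab C'" if "C \<in> conn_components D S" "C' \<in> conn_components D S" "C \<noteq> C'" for C C'
  proof
    assume "index_word lab C = index_word lab C'"
    moreover have "finite C" "finite C'" using conn_components_subset that assms finite_subset by metis+
    ultimately have "lab ` C = lab ` C'" unfolding index_word_def
      by (metis finite_imageI set_sorted_list_of_set)
    then show False using conn_components_subset that assms by (metis inj_on_image_eq_iff)
  qed
  show "\<exists>Cs. set Cs = conn_components D S \<and> distinct Cs \<and> sorted_wrt (comp_greater lab D) Cs"
  proof (rule sorted_wrt_list_ex)
    show "finite (conn_components D S)"
      by (rule finite_subset[of _ "Pow (pverts D)"]) (use conn_components_subset assms in auto)
    show "comp_greater lab D x y \<or> comp_greater lab D y x"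
      if "x \<in> conn_components D S" "y \<in> conn_components D S" "x \<noteq> y" for x y
      using lexord_less_than_total[OF w[OF that]] unfolding comp_greater_def by linarith
    show "comp_greater lab D x z"
      if "comp_greater lab D x y" "comp_greater lab D y z" for x y z
      using that lexord_less_than_trans[of "index_word lab z" "index_word lab y" "index_word lab x"]
      unfolding comp_greater_def by linarith
  qed
next
  have "\<not> comp_greater lab D C' C" if "comp_greater lab D C C'" for C C'
    using that lexord_less_than_asym[of "index_word lab C'" "index_word lab C"]
    unfolding comp_greater_def by linarith
  then show "Cs = Cs'"
    if "set Cs = conn_components D S \<and> distinct Cs \<and> sorted_wrt (comp_greater lab D) Cs"
      "set Cs' = conn_components D S \<and> distinct Cs' \<and> sorted_wrt (comp_greater lab D) Cs'" for Cs Cs'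
    using that sorted_wrt_list_unique[of "comp_greater lab D" Cs Cs'] by simp
qed

text \<open>The definite description below is well-defined by the preceding lemma.\<close>

definition comp_list ::
  "('v \<Rightarrow> nat) \<Rightarrow> 'v pair_pre_digraph \<Rightarrow> ('v \<times> 'v) set \<Rightarrow> 'v set list" where
  "comp_list lab D S =
     (THE Cs. set Cs = conn_components D S \<and> distinct Cs \<and> sorted_wrt (comp_greater lab D) Cs)"

definition alpha_comp :: "('v \<Rightarrow> nat) \<Rightarrow> 'v pair_pre_digraph \<Rightarrow> ('v \<times> 'v) set \<Rightarrow> nat list" where
  "alpha_comp lab D S = map card (comp_list lab D S)"

definition chromatic_nsym :: "('v \<Rightarrow> nat) \<Rightarrow> 'v pair_pre_digraph \<Rightarrow> 'k::field nsym" where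
  "chromatic_nsym lab D = (\<Sum>S\<in>Pow (parcs D). (- 1) ^ card S * nsym_Psi_comp (alpha_comp lab D S))"

end

theory Submission
  imports Defs
begin

text \<open>
  Both claims follow from the leading term of each generator: \<open>X\<^sub>n\<close> is homogeneous of weight \<open>n\<close>
  and the coefficient of \<open>H\<^sub>n\<close> in it does not vanish, all other words having at least two letters.
  That coefficient is \<open>n \<cdot> (\<Sum>S. (-1)\<^bsup>|S|\<^esup>)\<close>, summed over the connected spanning arc sets \<open>S\<close>:
  the factor \<open>n\<close> is the coefficient of \<open>H\<^sub>n\<close> in \<open>\<Psi>\<^sub>n\<close>, and \<open>\<Psi>\<^sub>\<alpha>\<close> contributes only if \<open>\<alpha> = (n)\<close>.
  By deletion-contraction the alternating sum has the strict sign \<open>(-1)\<^bsup>n-1\<^esup>\<close>.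
\<close>

section \<open>Connected spanning arc sets\<close>

text \<open>Connectedness through cuts: every nonempty vertex set without crossing arcs is all of
  \<open>V\<close>. Separate end maps let a contraction change only these maps and \<open>V\<close>,
  while loops and parallel arcs that arise remain distinct arcs.\<close>

definition connects :: "('e \<Rightarrow> 'v) \<Rightarrow> ('e \<Rightarrow> 'v) \<Rightarrow> 'v set \<Rightarrow> 'e set \<Rightarrow> bool" where
  "connects s t V S \<longleftrightarrow>
     (\<forall>U\<subseteq>V. U \<noteq> {} \<longrightarrow> (\<forall>e\<in>S. s e \<in> U \<longleftrightarrow> t e \<in> U) \<longrightarrow> U = V)"

text \<open>For finite nonempty \<open>V\<close> and finite \<open>E\<close> with ends in
  \<open>V\<close>, this is the linear coefficient of the chromatic polynomial, by its expansion
  over edge subsets.\<close>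

definition connected_sum :: "('e \<Rightarrow> 'v) \<Rightarrow> ('e \<Rightarrow> 'v) \<Rightarrow> 'v set \<Rightarrow> 'e set \<Rightarrow> int" where
  "connected_sum s t V E = (\<Sum>S\<in>Pow E. (- 1) ^ card S * of_bool (connects s t V S))"

definition merge :: "'v \<Rightarrow> 'v \<Rightarrow> 'v \<Rightarrow> 'v" where
  "merge u v x = (if x = v then u else x)"

lemma connects_insert_loop: "s e = t e \<Longrightarrow> connects s t V (insert e S) = connects s t V S"
  by (simp add: connects_def)

text \<open>A set without crossing arcs contains both ends of \<open>e\<close> or neither, so such
  sets correspond to those of the contraction: removal of \<open>t e\<close> in one direction,
  preimage under \<open>merge\<close> in the other.\<close>

lemma connects_insert_contract:
  assumes "s e \<noteq> t e" "s e \<in> V" "t e \<in> V"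
    and ends: "\<And>e'. e' \<in> S \<Longrightarrow> s e' \<in> V \<and> t e' \<in> V"
  shows "connects s t V (insert e S) \<longleftrightarrow>
    connects (merge (s e) (t e) \<circ> s) (merge (s e) (t e) \<circ> t) (V - {t e}) S"
proof
  let ?c = "merge (s e) (t e)"
  assume conn: "connects s t V (insert e S)"
  show "connects (?c \<circ> s) (?c \<circ> t) (V - {t e}) S"
    unfolding connects_def
  proof (intro allI impI)
    fix U assume U: "U \<subseteq> V - {t e}" "U \<noteq> {}" "\<forall>e'\<in>S. (?c \<circ> s) e' \<in> U \<longleftrightarrow> (?c \<circ> t) e' \<in> U"
    let ?U = "{x \<in> V. ?c x \<in> U}"
    have U_sub: "U \<subseteq> ?U" using U(1) by (auto simp: merge_def)
    have "\<forall>e'\<in>insert e S. s e' \<in> ?U \<longleftrightarrow> t e' \<in> ?U"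
      using U(3) ends assms by (auto simp: merge_def)
    moreover have "?U \<subseteq> V" "?U \<noteq> {}" using U_sub U(2) by auto
    ultimately have "?U = V" using conn[unfolded connects_def, rule_format, of ?U] by blast
    then have "?c x \<in> U" if "x \<in> V" for x using that by blast
    then have "x \<in> U" if "x \<in> V - {t e}" for x
      using that by (metis DiffE merge_def singletonI)
    then show "U = V - {t e}" using U(1) by blast
  qed
next
  let ?c = "merge (s e) (t e)"
  assume conn: "connects (?c \<circ> s) (?c \<circ> t) (V - {t e}) S"
  show "connects s t V (insert e S)"
    unfolding connects_def
  proof (intro allI impI)
    fix U assume U: "U \<subseteq> V" "U \<noteq> {}" "\<forall>e'\<in>insert e S. s e' \<in> U \<longleftrightarrow> t e' \<in> U"
    let ?U = "U - {t e}"
    have st: "s e \<in> U \<longleftrightarrow> t e \<in> U" using U(3) by simp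
    have c: "?c x \<in> ?U \<longleftrightarrow> x \<in> U" for x
      using st assms(1) by (auto simp: merge_def)
    have "\<forall>e'\<in>S. (?c \<circ> s) e' \<in> ?U \<longleftrightarrow> (?c \<circ> t) e' \<in> ?U"
      using U(3) unfolding comp_apply c by simp
    moreover have "?U \<subseteq> V - {t e}" using U(1) by blast
    moreover have "?U \<noteq> {}" using U(2) st assms(1) by blast
    ultimately have "?U = V - {t e}"
      using conn[unfolded connects_def, rule_format, of ?U] by blast
    then show "U = V" using U(1) st assms(1,2) by blast
  qed
qed

text \<open>Splits the subsets by whether they contain \<open>e\<close>; those that do have one more
  element, hence the minus sign.\<close>

lemma connected_sum_insert:
  assumes "finite E" "e \<notin> E"
  shows "connected_sum s t V (insert e E) = connected_sum s t V E -
    (\<Sum>S\<in>Pow E. (- 1) ^ card S * of_bool (connects s t V (insert e S)))"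
proof -
  have inj: "inj_on (insert e) (Pow E)" using assms(2) by (auto simp: inj_on_def)
  have card: "card (insert e S) = Suc (card S)" if "S \<in> Pow E" for S
    using that assms by (metis PowD card_insert_disjoint finite_subset subsetD)
  have "connected_sum s t V (insert e E) = connected_sum s t V E +
     (\<Sum>S\<in>insert e ` Pow E. (- 1) ^ card S * of_bool (connects s t V S))"
    unfolding connected_sum_def Pow_insert
    by (rule sum.union_disjoint) (use assms in auto)
  also have "(\<Sum>S\<in>insert e ` Pow E. (- 1) ^ card S * of_bool (connects s t V S)) =
      (\<Sum>S\<in>Pow E. - ((- 1) ^ card S * of_bool (connects s t V (insert e S)) :: int))"
    using inj by (simp add: sum.reindex card)
  finally show ?thesis by (simp add: sum_negf)
qed

text \<open>Deletion-contraction: contracting lowers \<open>card V\<close> by one, so after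
  normalising signs both contributions are at most 0 and cannot cancel. The weak bound is stated for
  all arc sets because deletion can disconnect and contraction can create loops.\<close>

lemma connected_sum_sign:
  assumes "finite E" "finite V" "V \<noteq> {}" "\<And>e. e \<in> E \<Longrightarrow> s e \<in> V \<and> t e \<in> V"
  shows "(- 1) ^ card V * connected_sum s t V E \<le> 0 \<and>
    (connects s t V E \<and> (\<forall>e\<in>E. s e \<noteq> t e) \<longrightarrow> (- 1) ^ card V * connected_sum s t V E < 0)"
  using assms
proof (induction E arbitrary: s t V rule: finite_induct)
  case empty
  \<comment> \<open>Without arcs only a single vertex is connected; there the sum is 1 and the sign
    factor is -1.\<close>
  have "card V = 1" if "connects s t V {}"
  proof -
    obtain x where "x \<in> V" using empty.prems(2) by blast
    then have "V = {x}" using that unfolding connects_def by blast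
    then show ?thesis by simp
  qed
  then show ?case by (cases "connects s t V {}") (auto simp: connected_sum_def)
next
  case (insert e E)
  note split = connected_sum_insert[OF insert.hyps]
  show ?case
  proof (cases "s e = t e")
    case True
    \<comment> \<open>A loop does not affect connectedness, so the terms of \<open>S\<close> and
      \<open>insert e S\<close> cancel.\<close>
    then have "connected_sum s t V (insert e E) = 0"
      unfolding split by (simp add: connects_insert_loop connected_sum_def)
    then show ?thesis using True by auto
  next
    case False
    let ?c = "merge (s e) (t e)"
    let ?s = "?c \<circ> s" and ?t = "?c \<circ> t" and ?V = "V - {t e}"
    have e: "s e \<in> V" "t e \<in> V" using insert.prems(3) by auto
    have ends: "s e' \<in> V \<and> t e' \<in> V" if "e' \<in> E" for e' using insert.prems(3) that by auto
    have contract: "connects s t V (insert e S) = connects ?s ?t ?V S" if "S \<subseteq> E" for S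
      by (rule connects_insert_contract) (use False e ends that in auto)
    have sum: "connected_sum s t V (insert e E) = connected_sum s t V E - connected_sum ?s ?t ?V E"
      unfolding split unfolding connected_sum_def by (simp add: contract)
    have cardV: "card V = Suc (card ?V)"
      using e insert.prems(1) by (metis card_Suc_Diff1)
    have "?s e' \<in> ?V \<and> ?t e' \<in> ?V" if "e' \<in> E" for e'
      using ends[OF that] e False by (auto simp: merge_def)
    moreover have "?V \<noteq> {}" using e False by blast
    ultimately have contracted: "(- 1) ^ card ?V * connected_sum ?s ?t ?V E \<le> 0"
        "connects ?s ?t ?V E \<Longrightarrow> \<forall>e\<in>E. ?s e \<noteq> ?t e \<Longrightarrow>
          (- 1) ^ card ?V * connected_sum ?s ?t ?V E < 0"
      using insert.IH[of ?V ?s ?t] insert.prems(1) by blast+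
    have deleted: "(- 1) ^ card V * connected_sum s t V E \<le> 0"
        "connects s t V E \<Longrightarrow> \<forall>e\<in>E. s e \<noteq> t e \<Longrightarrow> (- 1) ^ card V * connected_sum s t V E < 0"
      using insert.IH[of V s t] insert.prems(1,2) ends by blast+
    have signs: "(- 1) ^ card V * connected_sum s t V (insert e E) =
        (- 1) ^ card V * connected_sum s t V E + (- 1) ^ card ?V * connected_sum ?s ?t ?V E"
      unfolding sum cardV by (simp add: algebra_simps)
    \<comment> \<open>One of the two contributions is strict: the deletion if it stays connected,
      otherwise the contraction, which is then loopless.\<close>
    have "(- 1) ^ card V * connected_sum s t V (insert e E) < 0"
      if conn: "connects s t V (insert e E)" and loopless: "\<forall>e'\<in>insert e E. s e' \<noteq> t e'"
    proof (cases "connects s t V E")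
      case True
      then show ?thesis using signs deleted(2) contracted(1) loopless by auto
    next
      case del: False
      \<comment> \<open>An arc that becomes a loop under the contraction is parallel to \<open>e\<close>, so that deleting \<open>e\<close>
        would not disconnect.\<close>
      have "?s e' \<noteq> ?t e'" if "e' \<in> E" for e'
      proof
        assume "?s e' = ?t e'"
        then have "s e' = s e \<and> t e' = t e \<or> s e' = t e \<and> t e' = s e"
          using loopless that by (auto simp: merge_def split: if_splits)
        then have "connects s t V E = connects s t V (insert e E)"
          unfolding connects_def using that by (smt (verit, best) insert_iff)
        then show False using conn del by simp
      qed
      then show ?thesis using signs deleted(1) contracted(2) contract[of E] conn by auto
    qed
    then show ?thesis using signs deleted(1) contracted(1) by auto
  qed
qed

section \<open>Graded pieces of the free algebra\<close>

text \<open>The factorizations of a word in the free monoid are its cuts into a prefix and a suffix,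
  which turns the convolution into a finite sum over cut positions.\<close>

lemma lookup_mult_Word:
  "Poly_Mapping.lookup (p * q :: ('a, 'k::field) ncpoly) (Word w) =
     (\<Sum>i\<le>length w. Poly_Mapping.lookup p (Word (take i w)) * Poly_Mapping.lookup q (Word (drop i w)))"
proof -
  let ?f = "\<lambda>i. Word (take i w)"
  let ?g = "\<lambda>l. Poly_Mapping.lookup p l * Sum_any (\<lambda>r. Poly_Mapping.lookup q r when Word w = l + r)"
  have zero: "?g l = 0" if "l \<notin> ?f ` {..length w}" for l
  proof -
    have "Word w \<noteq> l + r" for r
    proof
      assume "Word w = l + r"
      then have "l = ?f (length (letters l))" "length (letters l) \<le> length w"
        by (auto simp: plus_free_monoid_def)
      then show False using that by blast
    qed
    then show ?thesis by simp
  qed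
  have inj: "inj_on ?f {..length w}"
    by (rule inj_onI) (metis atMost_iff free_monoid.inject length_take min.absorb2)
  have eval: "?g (?f i) = Poly_Mapping.lookup p (?f i) * Poly_Mapping.lookup q (Word (drop i w))"
    if "i \<le> length w" for i
  proof -
    have "Word w = ?f i + r \<longleftrightarrow> r = Word (drop i w)" for r
      using append_eq_conv_conj[of "take i w" "letters r" w] that
      by (cases r) (auto simp: plus_free_monoid_def)
    then show ?thesis by simp
  qed
  have "Poly_Mapping.lookup (p * q) (Word w) = sum ?g (?f ` {..length w})"
    unfolding lookup_mult by (rule Sum_any.expand_superset) (use zero in blast)+
  also have "\<dots> = (\<Sum>i\<le>length w. ?g (?f i))" by (simp add: sum.reindex inj)
  finally show ?thesis by (simp add: eval)
qed

lemma lookup_nc_const_mult: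
  "Poly_Mapping.lookup (nc_const c * p :: ('a, 'k::field) ncpoly) w = c * Poly_Mapping.lookup p w"
proof (cases w)
  case (Word u)
  have "(\<Sum>i\<le>length u. Poly_Mapping.lookup (nc_const c) (Word (take i u)) *
      Poly_Mapping.lookup p (Word (drop i u))) =
    (\<Sum>i\<le>length u. if i = 0 then c * Poly_Mapping.lookup p (Word u) else 0)"
    by (rule sum.cong)
      (auto simp: nc_const_def lookup_single zero_free_monoid_def when_def)
  then show ?thesis by (simp add: Word lookup_mult_Word)
qed

lemma nsym_H_single: "nsym_H \<alpha> = Poly_Mapping.single (Word \<alpha>) (1 :: 'k::field)"
  by (induction \<alpha>)
    (auto simp: nsym_H_def nc_var_def mult_single plus_free_monoid_def zero_free_monoid_def
      simp flip: single_one)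

lemma ncpoly_expand:
  fixes p :: "(nat, 'k::field) ncpoly"
  shows "p = (\<Sum>w\<in>Poly_Mapping.keys p.
    nc_const (Poly_Mapping.lookup p w) * nsym_H (letters w))"
proof -
  have "nc_const c * nsym_H (letters w) = Poly_Mapping.single w c"
    for c :: 'k and w :: "nat free_monoid"
    by (simp add: nc_const_def nsym_H_single mult_single)
  then show ?thesis
    by (intro poly_mapping_eqI)
      (simp add: lookup_sum lookup_single when_def in_keys_iff)
qed

text \<open>Homogeneous of weight \<open>n\<close>, filtered by word length: for \<open>k\<close> at
  least 2 the word \<open>[n]\<close> cannot occur. The composition condition excludes the letter 0
  of the ambient type.\<close>

definition graded :: "nat \<Rightarrow> nat \<Rightarrow> (nat, 'k::field) ncpoly set" where
  "graded n k = {p. \<forall>w\<in>Poly_Mapping.keys p.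
     is_composition (letters w) \<and> sum_list (letters w) = n \<and> k \<le> length (letters w)}"

lemma graded_0: "0 \<in> graded n k"
  by (simp add: graded_def)

lemma graded_add: "p \<in> graded n k \<Longrightarrow> q \<in> graded n k \<Longrightarrow> p + q \<in> graded n k"
  using keys_add[of p q] by (auto simp: graded_def)

lemma graded_sum: "(\<And>i. i \<in> I \<Longrightarrow> f i \<in> graded n k) \<Longrightarrow> sum f I \<in> graded n k"
  by (induction I rule: infinite_finite_induct) (auto intro: graded_add graded_0)

lemma minus_one_power_mult: "(- 1) ^ m * p = p \<or> (- 1) ^ m * p = (- p :: 'a::ring_1)"
  by (cases "even m") auto

lemma graded_sign: "p \<in> graded n k \<Longrightarrow> (- 1) ^ m * p \<in> graded n k"
  using minus_one_power_mult[of m p] by (auto simp: graded_def)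

lemma lookup_sign:
  "Poly_Mapping.lookup ((- 1) ^ m * p :: ('a, 'k::field) ncpoly) w =
     (- 1) ^ m * Poly_Mapping.lookup p w"
  by (cases "even m") auto

lemma graded_mult:
  fixes p q :: "(nat, 'k::field) ncpoly"
  assumes "p \<in> graded m j" "q \<in> graded n k"
  shows "p * q \<in> graded (m + n) (j + k)"
proof -
  have "is_composition (letters w) \<and> sum_list (letters w) = m + n \<and> j + k \<le> length (letters w)"
    if w: "w \<in> Poly_Mapping.keys (p * q)" for w
  proof -
    obtain u v where "w = u + v" "u \<in> Poly_Mapping.keys p" "v \<in> Poly_Mapping.keys q"
      using subsetD[OF keys_mult w] by blast
    then show ?thesis
      using assms by (auto simp: graded_def plus_free_monoid_def is_composition_def add_mono)
  qed
  then show ?thesis by (simp add: graded_def)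
qed

text \<open>Weights add up, and each factor contributes at least one letter, so the number of
  factors bounds the word length from below.\<close>

lemma graded_prod_list:
  "(\<And>a. a \<in> set \<alpha> \<Longrightarrow> f a \<in> graded a 1) \<Longrightarrow>
     prod_list (map f \<alpha>) \<in> graded (sum_list \<alpha>) (length \<alpha>)"
proof (induction \<alpha>)
  case Nil
  then show ?case by (simp add: graded_def zero_free_monoid_def is_composition_def)
next
  case (Cons a \<alpha>)
  then show ?case using graded_mult[of "f a" a 1] by simp
qed

lemma graded_antimono: "p \<in> graded n k \<Longrightarrow> j \<le> k \<Longrightarrow> p \<in> graded n j"
  by (auto simp: graded_def)

lemma lookup_graded_eq_0:
  "p \<in> graded n k \<Longrightarrow> \<not> (is_composition w \<and> sum_list w = n \<and> k \<le> length w) \<Longrightarrow>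
     Poly_Mapping.lookup p (Word w) = 0"
  by (metis (mono_tags, lifting) free_monoid.sel graded_def in_keys_iff mem_Collect_eq)

section \<open>Families with nonvanishing leading coefficients\<close>

text \<open>A further part of size at least 1 must be present. This gives triangularity: apart from
  \<open>[n]\<close>, words of weight \<open>n\<close> use only smaller generators.\<close>

lemma composition_letter_less:
  assumes "is_composition w" "sum_list w = n" "w \<noteq> [n]" "a \<in> set w"
  shows "a < n"
proof -
  obtain u v where w: "w = u @ a # v" using assms(4) by (meson split_list)
  have "u @ v \<noteq> []" using assms(2,3) w by auto
  then obtain b where "b \<in> set (u @ v)" by (meson last_in_set)
  then have "b \<ge> 1" "b \<le> sum_list (u @ v)"
    using assms(1) w member_le_sum_list[of b "u @ v"] by (auto simp: is_composition_def)
  then show ?thesis using assms(2) w by simp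
qed

section \<open>Closure properties of subalgebras\<close>

lemma
  assumes "nc_subalgebra A"
  shows nc_subalgebra_sum: "(\<And>i. i \<in> I \<Longrightarrow> f i \<in> A) \<Longrightarrow> sum f I \<in> A"
    and nc_subalgebra_prod_list: "(\<And>a. a \<in> set l \<Longrightarrow> g a \<in> A) \<Longrightarrow> prod_list (map g l) \<in> A"
    and nc_subalgebra_const_mult: "p \<in> A \<Longrightarrow> nc_const c * p \<in> A"
    and nc_subalgebra_diff: "p \<in> A \<Longrightarrow> q \<in> A \<Longrightarrow> p - q \<in> A"
proof -
  have closed: "1 \<in> A" "\<And>c a. a \<in> A \<Longrightarrow> nc_const c * a \<in> A"
      "\<And>a b. a \<in> A \<Longrightarrow> b \<in> A \<Longrightarrow> a + b \<in> A" "\<And>a b. a \<in> A \<Longrightarrow> b \<in> A \<Longrightarrow> a * b \<in> A"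
    using assms by (auto simp: nc_subalgebra_def)
  \<comment> \<open>Zero and negatives come from scaling, by 0 and by -1.\<close>
  have "0 \<in> A" using closed(2)[OF closed(1), of 0] by (simp add: nc_const_def)
  then show "(\<And>i. i \<in> I \<Longrightarrow> f i \<in> A) \<Longrightarrow> sum f I \<in> A"
    by (induction I rule: infinite_finite_induct) (auto intro: closed)
  show "(\<And>a. a \<in> set l \<Longrightarrow> g a \<in> A) \<Longrightarrow> prod_list (map g l) \<in> A"
    by (induction l) (auto intro: closed)
  show "nc_const c * p \<in> A" if "p \<in> A" using closed that by blast
  have neg: "nc_const (- 1) * q = - q"
    by (rule poly_mapping_eqI) (simp add: lookup_nc_const_mult)
  show "p - q \<in> A" if "p \<in> A" "q \<in> A"
    using closed(3)[OF that(1) closed(2)[OF that(2), of "- 1"]] unfolding neg by simp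
qed

lemma nc_subalgebra_NSym: "nc_subalgebra (NSym :: 'k::field nsym set)"
proof -
  have "p * q \<in> NSym" if "p \<in> NSym" "q \<in> NSym" for p q :: "'k nsym"
    using that keys_mult[of p q] by (fastforce simp: NSym_def free_algebra_def plus_free_monoid_def)
  moreover have "p + q \<in> NSym" if "p \<in> NSym" "q \<in> NSym" for p q :: "'k nsym"
    using that keys_add[of p q] by (fastforce simp: NSym_def free_algebra_def)
  moreover have "nc_const c \<in> NSym" for c :: 'k
    by (auto simp: NSym_def free_algebra_def nc_const_def zero_free_monoid_def)
  moreover have "(1 :: 'k nsym) \<in> NSym"
    by (auto simp: NSym_def free_algebra_def zero_free_monoid_def)
  ultimately show ?thesis by (simp add: nc_subalgebra_def)
qed

section \<open>Triangular families: generation and independence\<close>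

context
  fixes x :: "nat \<Rightarrow> 'k::field nsym"
  assumes graded: "\<And>n. n \<ge> 1 \<Longrightarrow> x n \<in> graded n 1"
    and leading: "\<And>n. n \<ge> 1 \<Longrightarrow> Poly_Mapping.lookup (x n) (Word [n]) \<noteq> 0"
begin

text \<open>Strong induction on \<open>n\<close>: \<open>x n\<close> is a nonzero multiple of the
  generator \<open>n\<close> plus words in smaller generators, so it can be solved for that
  generator.\<close>

lemma nc_var_in_subalgebra:
  assumes A: "nc_subalgebra A" "x ` {1..} \<subseteq> A" and "n \<ge> 1"
  shows "nc_var n \<in> A"
  using \<open>n \<ge> 1\<close>
proof (induction n rule: less_induct)
  case (less n)
  let ?d = "Poly_Mapping.lookup (x n) (Word [n])"
  let ?K = "Poly_Mapping.keys (x n)"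
  let ?f = "\<lambda>w. nc_const (Poly_Mapping.lookup (x n) w) * nsym_H (letters w)"
  have rest: "nsym_H (letters w) \<in> A" if "w \<in> ?K - {Word [n]}" for w
    unfolding nsym_H_def
  proof (rule nc_subalgebra_prod_list[OF A(1)])
    fix a assume a: "a \<in> set (letters w)"
    have w: "is_composition (letters w)" "sum_list (letters w) = n" "letters w \<noteq> [n]"
      using that graded[OF less.prems] by (auto simp: graded_def)
    then have "a < n" using a by (metis composition_letter_less)
    moreover have "a \<ge> 1" using w(1) a by (simp add: is_composition_def)
    ultimately show "nc_var a \<in> A" by (rule less.IH)
  qed
  have "x n = ?f (Word [n]) + sum ?f (?K - {Word [n]})"
    using ncpoly_expand[of "x n"] sum.remove[of ?K "Word [n]" ?f] leading[OF less.prems]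
    by (simp add: in_keys_iff)
  moreover have "?f (Word [n]) = nc_const ?d * nc_var n" by (simp add: nsym_H_def)
  ultimately have "nc_const ?d * nc_var n = x n - sum ?f (?K - {Word [n]})"
    by (simp only: eq_diff_eq)
  also have "\<dots> \<in> A"
    using A less.prems rest
    by (intro nc_subalgebra_diff nc_subalgebra_sum nc_subalgebra_const_mult) auto
  \<comment> \<open>The leading coefficient is nonzero in a field, so it can be divided out.\<close>
  finally have "nc_const (1 / ?d) * (nc_const ?d * nc_var n) \<in> A"
    by (rule nc_subalgebra_const_mult[OF A(1)])
  moreover have "nc_const (1 / ?d) * (nc_const ?d * nc_var n) = nc_var n"
    by (rule poly_mapping_eqI) (use leading[OF less.prems] in \<open>simp add: lookup_nc_const_mult\<close>)
  ultimately show ?case by simp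
qed

lemma nc_subalgebra_hull_eq_NSym: "nc_subalgebra hull (x ` {1..}) = NSym"
proof (rule hull_unique)
  show "x ` {1..} \<subseteq> NSym"
    using graded by (fastforce simp: graded_def NSym_def free_algebra_def is_composition_def)
  show "nc_subalgebra (NSym :: 'k nsym set)" by (rule nc_subalgebra_NSym)
  fix A assume A: "x ` {1..} \<subseteq> A" "nc_subalgebra A"
  show "NSym \<subseteq> A"
  proof
    fix p :: "'k nsym" assume "p \<in> NSym"
    then have "nsym_H (letters w) \<in> A" if "w \<in> Poly_Mapping.keys p" for w
      unfolding nsym_H_def using that A
      by (intro nc_subalgebra_prod_list nc_var_in_subalgebra)
        (auto simp: NSym_def free_algebra_def)
    then show "p \<in> A"
      by (subst ncpoly_expand) (intro nc_subalgebra_sum nc_subalgebra_const_mult A(2))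
  qed
qed

text \<open>Every factor supplies at least one letter. A word no longer than \<open>v\<close>
  therefore takes exactly one letter from each factor, and homogeneity forces the letter taken from
  \<open>x a\<close> to be \<open>a\<close>.\<close>

lemma lookup_prod_list_short:
  assumes "\<forall>a\<in>set v. a \<ge> 1" "length w \<le> length v"
  shows "Poly_Mapping.lookup (prod_list (map x v)) (Word w) =
    (if w = v then \<Prod>a\<leftarrow>v. Poly_Mapping.lookup (x a) (Word [a]) else 0)"
  using assms
proof (induction v arbitrary: w)
  case Nil
  then show ?case by (simp add: lookup_single zero_free_monoid_def flip: single_one)
next
  case (Cons a v)
  have a: "x a \<in> graded a 1" "a \<ge> 1" using Cons.prems(1) graded by auto
  show ?case
  proof (cases w)
    case Nil
    then show ?thesis
      using lookup_graded_eq_0[OF a(1), of "[]"] by (simp add: lookup_mult_Word)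
  next
    case (Cons b u)
    let ?d = "\<lambda>a. Poly_Mapping.lookup (x a) (Word [a])"
    \<comment> \<open>Only the cut after the first letter survives: \<open>x a\<close> has no
      constant term, and a later cut leaves fewer letters than there are remaining factors.\<close>
    have split_term: "Poly_Mapping.lookup (x a) (Word (take i w)) *
          Poly_Mapping.lookup (prod_list (map x v)) (Word (drop i w)) =
        (if i = 1 then if w = a # v then ?d a * (\<Prod>a\<leftarrow>v. ?d a) else 0 else 0)"
      if "i \<le> length w" for i
    proof -
      consider "i = 0" | "i = 1" | "i \<ge> 2" by linarith
      then show ?thesis
      proof cases
        case 1
        then show ?thesis using lookup_graded_eq_0[OF a(1), of "[]"] by simp
      next
        case 2
        have "Poly_Mapping.lookup (x a) (Word [b]) = 0" if "a \<noteq> b"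
          using lookup_graded_eq_0[OF a(1), of "[b]"] that by simp
        then show ?thesis using 2 Cons Cons.IH[of u] Cons.prems by auto
      next
        case 3
        then have "length (drop i w) < length v" using that Cons.prems(2) Cons by simp
        then show ?thesis using 3 Cons.IH[of "drop i w"] Cons.prems(1) by auto
      qed
    qed
    have "Poly_Mapping.lookup (prod_list (map x (a # v))) (Word w) = (\<Sum>i\<le>length w.
        if i = 1 then if w = a # v then ?d a * (\<Prod>a\<leftarrow>v. ?d a) else 0 else 0)"
      by (simp only: list.map prod_list.Cons lookup_mult_Word)
        (intro sum.cong refl, rule split_term, simp)
    also have "\<dots> = (if w = a # v then ?d a * (\<Prod>a\<leftarrow>v. ?d a) else 0)"
      unfolding sum.delta[OF finite_atMost] using Cons by (auto simp: Suc_le_eq)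
    finally show ?thesis by simp
  qed
qed

text \<open>In a nontrivial relation consider a shortest word \<open>w\<close>. By
  \<open>lookup_prod_list_short\<close> no other word of the relation contributes to the coefficient
  of \<open>w\<close> in the evaluation, which is thus a nonzero multiple of its coefficient in
  \<open>p\<close>.\<close>

lemma nc_independent_of_leading: "nc_independent {1..} x"
  unfolding nc_independent_def
proof (intro ballI impI, rule ccontr)
  fix p :: "(nat, 'k) ncpoly"
  assume p: "p \<in> free_algebra {1..}" "nc_eval x p = 0" "p \<noteq> 0"
  let ?K = "Poly_Mapping.keys p"
  obtain w where w: "w \<in> ?K" "\<And>v. v \<in> ?K \<Longrightarrow> length (letters w) \<le> length (letters v)"
    using p(3) ex_has_least_nat[of "\<lambda>v. v \<in> ?K" _ "\<lambda>v. length (letters v)"]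
    by (metis equals0I keys_eq_empty)
  let ?P = "\<Prod>a\<leftarrow>letters w. Poly_Mapping.lookup (x a) (Word [a])"
  have letters_pos: "\<forall>a\<in>set (letters v). a \<ge> 1" if "v \<in> ?K" for v
    using p(1) that by (auto simp: free_algebra_def)
  have "Poly_Mapping.lookup (prod_list (map x (letters v))) w = (if v = w then ?P else 0)"
    if "v \<in> ?K" for v
    using lookup_prod_list_short[OF letters_pos[OF that] w(2)[OF that]]
    by (auto intro: free_monoid.expand)
  then have "Poly_Mapping.lookup (nc_eval x p) w =
      (\<Sum>v\<in>?K. if v = w then Poly_Mapping.lookup p w * ?P else 0)"
    unfolding nc_eval_def lookup_sum by (intro sum.cong) (auto simp: lookup_nc_const_mult)
  then have "Poly_Mapping.lookup p w * ?P = 0" using w(1) p(2) by simp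
  moreover have "?P \<noteq> 0"
    using letters_pos[OF w(1)] leading by (auto simp: prod_list_zero_iff)
  moreover have "Poly_Mapping.lookup p w \<noteq> 0" using w(1) by (simp add: in_keys_iff)
  ultimately show False by simp
qed

end

section \<open>The power sums\<close>

lemma nsym_H_graded:
  "is_composition \<alpha> \<Longrightarrow> sum_list \<alpha> = n \<Longrightarrow> k \<le> length \<alpha> \<Longrightarrow> nsym_H \<alpha> \<in> graded n k"
  by (simp add: nsym_H_single graded_def)

lemma nsym_R_graded: "sum_list \<alpha> = n \<Longrightarrow> n \<ge> 1 \<Longrightarrow> nsym_R \<alpha> \<in> graded n 1"
  unfolding nsym_R_def
  by (intro graded_sum graded_sign nsym_H_graded)
    (auto simp: coarsenings_def Suc_le_eq simp del: sum_list_eq_0_iff)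

text \<open>Only the coarsest composition \<open>[n]\<close>, which has empty descent set, yields
  the word \<open>[n]\<close>.\<close>

lemma lookup_nsym_R:
  assumes "sum_list \<alpha> = n" "n \<ge> 1"
  shows "Poly_Mapping.lookup (nsym_R \<alpha> :: 'k::field nsym) (Word [n]) = (- 1) ^ (length \<alpha> - 1)"
proof -
  have "[n] \<in> coarsenings \<alpha>"
    using assms by (simp add: coarsenings_def is_composition_def descent_set_def)
  moreover have "Poly_Mapping.lookup (nsym_R \<alpha> :: 'k nsym) (Word [n]) =
      (\<Sum>\<beta>\<in>coarsenings \<alpha>. if \<beta> = [n] then (- 1) ^ (length \<alpha> - 1) else 0)"
    unfolding nsym_R_def lookup_sum lookup_sign nsym_H_single
    by (rule sum.cong) (auto simp: lookup_single)
  ultimately show ?thesis by (simp add: finite_coarsenings)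
qed

lemma nsym_Psi_graded: "n \<ge> 1 \<Longrightarrow> nsym_Psi n \<in> graded n 1"
  unfolding nsym_Psi_def
  by (intro graded_sum graded_sign nsym_R_graded) (auto simp: sum_list_replicate)

text \<open>The composition (1^i, n-i) has length i+1, so its ribbon contributes (-1)^i, which
  cancels the sign in the definition; the \<open>n\<close> summands each give 1.\<close>

lemma lookup_nsym_Psi:
  "n \<ge> 1 \<Longrightarrow> Poly_Mapping.lookup (nsym_Psi n :: 'k::field nsym) (Word [n]) = of_nat n"
  unfolding nsym_Psi_def lookup_sum lookup_sign
  by (simp add: lookup_nsym_R sum_list_replicate flip: power_add mult_2)

lemma nsym_Psi_comp_graded:
  "is_composition \<alpha> \<Longrightarrow> nsym_Psi_comp \<alpha> \<in> graded (sum_list \<alpha>) (length \<alpha>)"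
  unfolding nsym_Psi_comp_def
  by (rule graded_prod_list) (simp add: is_composition_def nsym_Psi_graded[unfolded One_nat_def])

text \<open>A product of two or more power sums has only words of at least two letters, so it misses
  \<open>[n]\<close>.\<close>

lemma lookup_nsym_Psi_comp:
  assumes "is_composition \<alpha>" "sum_list \<alpha> = n" "n \<ge> 1"
  shows "Poly_Mapping.lookup (nsym_Psi_comp \<alpha> :: 'k::field nsym) (Word [n]) =
    of_nat n * of_bool (length \<alpha> = 1)"
proof (cases "length \<alpha> = 1")
  case True
  then obtain a where "\<alpha> = [a]" by (auto simp: length_Suc_conv)
  then show ?thesis using assms by (simp add: nsym_Psi_comp_def lookup_nsym_Psi)
next
  case False
  moreover have "\<alpha> \<noteq> []" using assms by auto
  ultimately have "\<not> length \<alpha> \<le> 1" by (cases \<alpha>) auto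
  then show ?thesis
    using False lookup_graded_eq_0[OF nsym_Psi_comp_graded[OF assms(1)], of "[n]"] by simp
qed

section \<open>Components and the coefficient of \<open>H\<^sub>n\<close>\<close>

abbreviation spanning_sym :: "'v pair_pre_digraph \<Rightarrow> ('v \<times> 'v) set \<Rightarrow> ('v, 'v \<times> 'v) pre_digraph" where
  "spanning_sym D S \<equiv> with_proj (mk_symmetric (with_proj \<lparr>pverts = pverts D, parcs = S\<rparr>))"

lemma in_arcs_ends_spanning_sym:
  "(u, v) \<in> arcs_ends (spanning_sym D S) \<longleftrightarrow> (u, v) \<in> S \<or> (v, u) \<in> S"
  by (auto simp: mk_symmetric_def arcs_ends_def arc_to_ends_def intro: bexI[of _ "(v, u)"])

lemma reachable_spanning_sym_sym:
  "u \<rightarrow>\<^sup>*\<^bsub>spanning_sym D S\<^esub> v \<Longrightarrow> v \<rightarrow>\<^sup>*\<^bsub>spanning_sym D S\<^esub> u"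
  by (rule symmetric_reachable[OF symmetric_mk_symmetric])

text \<open>Stated for arbitrary graphs: where \<open>S\<close> is unrestricted,
  \<open>spanning_sym D S\<close> may have arcs leaving the vertex set.\<close>

lemma reachable_trans': "u \<rightarrow>\<^sup>*\<^bsub>G\<^esub> v \<Longrightarrow> v \<rightarrow>\<^sup>*\<^bsub>G\<^esub> w \<Longrightarrow> u \<rightarrow>\<^sup>*\<^bsub>G\<^esub> w"
  unfolding reachable_def by (rule rtrancl_on_trans)

text \<open>Links cuts with paths: the set reachable from a vertex has no crossing arcs, and
  conversely a set without crossing arcs contains whatever is reachable from any of its
  elements.\<close>

lemma connects_iff_reachable:
  assumes "S \<subseteq> pverts D \<times> pverts D"
  shows "connects fst snd (pverts D) S \<longleftrightarrow>
    (\<forall>u\<in>pverts D. \<forall>v\<in>pverts D. u \<rightarrow>\<^sup>*\<^bsub>spanning_sym D S\<^esub> v)"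
proof
  let ?G = "spanning_sym D S"
  assume conn: "connects fst snd (pverts D) S"
  show "\<forall>u\<in>pverts D. \<forall>v\<in>pverts D. u \<rightarrow>\<^sup>*\<^bsub>?G\<^esub> v"
  proof (intro ballI)
    fix u v assume uv: "u \<in> pverts D" "v \<in> pverts D"
    let ?U = "{w \<in> pverts D. u \<rightarrow>\<^sup>*\<^bsub>?G\<^esub> w}"
    have refl: "u \<rightarrow>\<^sup>*\<^bsub>?G\<^esub> u" using uv by (simp add: reachable_def)
    have step: "u \<rightarrow>\<^sup>*\<^bsub>?G\<^esub> b" if "u \<rightarrow>\<^sup>*\<^bsub>?G\<^esub> a" "(a, b) \<in> S \<or> (b, a) \<in> S" for a b
    proof -
      have "(a, b) \<in> arcs_ends ?G" using that(2) by (simp only: in_arcs_ends_spanning_sym)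
      moreover have "b \<in> verts ?G" using that(2) assms by auto
      ultimately show ?thesis
        using rtrancl_on_into_rtrancl_on[OF that(1)[unfolded reachable_def]]
        unfolding reachable_def by blast
    qed
    have "fst e \<in> ?U \<longleftrightarrow> snd e \<in> ?U" if "e \<in> S" for e
    proof -
      have "fst e \<in> pverts D" "snd e \<in> pverts D" using that assms by auto
      moreover have "(fst e, snd e) \<in> S" using that by simp
      ultimately show ?thesis using step by blast
    qed
    then have "?U = pverts D"
      using conn[unfolded connects_def, rule_format, of ?U] uv(1) refl by blast
    then show "u \<rightarrow>\<^sup>*\<^bsub>?G\<^esub> v" using uv(2) by blast
  qed
next
  let ?G = "spanning_sym D S"
  assume reach: "\<forall>u\<in>pverts D. \<forall>v\<in>pverts D. u \<rightarrow>\<^sup>*\<^bsub>?G\<^esub> v"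
  show "connects fst snd (pverts D) S"
    unfolding connects_def
  proof (intro allI impI)
    fix U assume U: "U \<subseteq> pverts D" "U \<noteq> {}" "\<forall>e\<in>S. fst e \<in> U \<longleftrightarrow> snd e \<in> U"
    obtain u where u: "u \<in> U" using U(2) by blast
    have "v \<in> U" if "u \<rightarrow>\<^sup>*\<^bsub>?G\<^esub> v" for v
      using that unfolding reachable_def
    proof (induction rule: rtrancl_on_induct)
      case (step a b)
      then have "(a, b) \<in> S \<or> (b, a) \<in> S" by (simp only: in_arcs_ends_spanning_sym)
      then show ?case using U(3) step.IH by fastforce
    qed (rule u)
    then show "U = pverts D" using U(1) u reach by blast
  qed
qed

lemma Union_conn_components: "\<Union> (conn_components D S) = pverts D"
proof
  show "\<Union> (conn_components D S) \<subseteq> pverts D" using conn_components_subset by blast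
  show "pverts D \<subseteq> \<Union> (conn_components D S)"
  proof
    let ?G = "spanning_sym D S"
    fix u assume "u \<in> pverts D"
    then have "u \<rightarrow>\<^sup>*\<^bsub>?G\<^esub> u" by (simp add: reachable_def)
    \<comment> \<open>By symmetry of the graph, whatever \<open>u\<close> reaches also reaches
      \<open>u\<close>, so this set is mutually reachable and maximal.\<close>
    moreover have "{v. u \<rightarrow>\<^sup>*\<^bsub>?G\<^esub> v} \<in> conn_components D S"
      unfolding conn_components_def pre_digraph.sccs_verts_def using calculation
      by (blast intro: reachable_trans' reachable_spanning_sym_sym)
    ultimately show "u \<in> \<Union> (conn_components D S)" by blast
  qed
qed

text \<open>By maximality a component consists of all vertices mutually reachable with any one of
  its elements, so a common element determines it.\<close>

lemma conn_components_disjoint: "pairwise disjnt (conn_components D S)"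
proof (rule pairwiseI, rule ccontr)
  fix B C assume B: "B \<in> conn_components D S" and C: "C \<in> conn_components D S"
    and "B \<noteq> C" "\<not> disjnt B C"
  then obtain u where u: "u \<in> B" "u \<in> C" by (auto simp: disjnt_def)
  have "v \<in> B \<longleftrightarrow> v \<in> C" for v
    using B C u unfolding conn_components_def pre_digraph.sccs_verts_def by blast
  then show False using \<open>B \<noteq> C\<close> by blast
qed

text \<open>The components cover the vertex set, so a sole component is the whole set; conversely,
  if all vertices reach each other, every component is the whole set by maximality.\<close>

lemma conn_components_singleton:
  assumes "S \<subseteq> pverts D \<times> pverts D" "pverts D \<noteq> {}"
  shows "is_singleton (conn_components D S) \<longleftrightarrow> connects fst snd (pverts D) S"
proof
  assume "is_singleton (conn_components D S)"
  then have "pverts D \<in> conn_components D S"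
    using Union_conn_components[of D S] by (auto elim!: is_singletonE)
  then show "connects fst snd (pverts D) S"
    unfolding connects_iff_reachable[OF assms(1)] conn_components_def pre_digraph.sccs_verts_def
    by blast
next
  assume "connects fst snd (pverts D) S"
  then have "pverts D \<subseteq> C" if "C \<in> conn_components D S" for C
    using that conn_components_subset[OF that] reachable_spanning_sym_sym[of D S]
    unfolding connects_iff_reachable[OF assms(1)] conn_components_def pre_digraph.sccs_verts_def
    by blast
  then have "C = pverts D" if "C \<in> conn_components D S" for C
    using that conn_components_subset[OF that] by blast
  moreover have "conn_components D S \<noteq> {}" using Union_conn_components[of D S] assms(2) by auto
  ultimately have "conn_components D S = {pverts D}" by blast
  then show "is_singleton (conn_components D S)" by simp
qed

text \<open>By \<open>comp_list_ex1\<close> the list enumerates the components without repetition,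
  so the parts of \<alpha>(S) are the block sizes of a partition of the vertex set into nonempty
  blocks.\<close>

lemma
  assumes "finite (pverts D)" "inj_on lab (pverts D)"
  shows length_alpha_comp: "length (alpha_comp lab D S) = card (conn_components D S)"
    and sum_list_alpha_comp: "sum_list (alpha_comp lab D S) = card (pverts D)"
    and is_composition_alpha_comp: "is_composition (alpha_comp lab D S)"
proof -
  have Cs: "set (comp_list lab D S) = conn_components D S" "distinct (comp_list lab D S)"
    using theI'[OF comp_list_ex1[OF assms, of S]] unfolding comp_list_def by blast+
  have fin: "finite C" "C \<noteq> {}" if "C \<in> conn_components D S" for C
    using conn_components_subset[OF that] assms(1) finite_subset by auto
  show "length (alpha_comp lab D S) = card (conn_components D S)"
    using distinct_card[OF Cs(2)] Cs(1) by (simp add: alpha_comp_def)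
  show "sum_list (alpha_comp lab D S) = card (pverts D)"
    unfolding alpha_comp_def sum_list_distinct_conv_sum_set[OF Cs(2)] Cs(1)
    using card_Union_disjoint[OF conn_components_disjoint, of D S] fin
    by (simp add: Union_conn_components)
  show "is_composition (alpha_comp lab D S)"
    using fin by (auto simp: is_composition_def alpha_comp_def Cs(1) Suc_le_eq card_gt_0_iff)
qed

lemma chromatic_nsym_graded:
  assumes "finite (pverts D)" "pverts D \<noteq> {}" "inj_on lab (pverts D)"
  shows "chromatic_nsym lab D \<in> graded (card (pverts D)) 1"
  unfolding chromatic_nsym_def
proof (intro graded_sum graded_sign)
  fix S
  have "alpha_comp lab D S \<noteq> []"
    using sum_list_alpha_comp[OF assms(1,3), of S] assms(1,2) by auto
  then show "nsym_Psi_comp (alpha_comp lab D S) \<in> graded (card (pverts D)) 1"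
    using nsym_Psi_comp_graded[OF is_composition_alpha_comp[OF assms(1,3), of S]]
    by (auto simp: sum_list_alpha_comp[OF assms(1,3)] Suc_le_eq intro: graded_antimono)
qed

text \<open>Only arc sets with a single component give a one-part \<alpha>(S), and each of these
  contributes its sign times \<open>n\<close>.\<close>

lemma lookup_chromatic_nsym:
  assumes "pair_digraph D" "pverts D \<noteq> {}" "inj_on lab (pverts D)"
  defines "n \<equiv> card (pverts D)"
  shows "Poly_Mapping.lookup (chromatic_nsym lab D :: 'k::field nsym) (Word [n]) =
    of_nat n * of_int (connected_sum fst snd (pverts D) (parcs D))"
proof -
  interpret pair_digraph D by fact
  have "n \<ge> 1" using assms(2) by (simp add: n_def Suc_le_eq card_gt_0_iff)
  have "Poly_Mapping.lookup (nsym_Psi_comp (alpha_comp lab D S) :: 'k nsym) (Word [n]) =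
      of_nat n * of_bool (connects fst snd (pverts D) S)" if "S \<subseteq> parcs D" for S
  proof -
    have "S \<subseteq> pverts D \<times> pverts D" using that in_arcsD1 in_arcsD2 by fastforce
    from conn_components_singleton[OF this assms(2)]
    have "length (alpha_comp lab D S) = 1 \<longleftrightarrow> connects fst snd (pverts D) S"
      by (simp add: length_alpha_comp[OF _ assms(3)] is_singleton_altdef)
    then show ?thesis
      using lookup_nsym_Psi_comp[of "alpha_comp lab D S" n] \<open>n \<ge> 1\<close> assms(3)
      by (simp add: is_composition_alpha_comp sum_list_alpha_comp n_def)
  qed
  then show ?thesis
    unfolding chromatic_nsym_def lookup_sum lookup_sign connected_sum_def
    by (simp add: sum_distrib_left mult.left_commute
        del: sum_mult_of_bool_eq sum_of_bool_mult_eq)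
qed

theorem theorem4:
  fixes D :: "nat \<Rightarrow> 'v pair_pre_digraph"
    and lab :: "nat \<Rightarrow> 'v \<Rightarrow> nat"
  assumes digraph: "\<And>i. i \<ge> 1 \<Longrightarrow> pair_digraph (D i)"
    and order: "\<And>i. i \<ge> 1 \<Longrightarrow> card (pverts (D i)) = i"
    and conn: "\<And>i. i \<ge> 1 \<Longrightarrow> Digraph_Component.connected (with_proj (D i))"
    and labeling: "\<And>i. i \<ge> 1 \<Longrightarrow> bij_betw (lab i) (pverts (D i)) {1..i}"
  shows "nc_subalgebra hull ((\<lambda>i. chromatic_nsym (lab i) (D i)) ` {1..}) =
           (NSym :: 'k::field_char_0 nsym set) \<and>
         nc_independent {1..} (\<lambda>i. chromatic_nsym (lab i) (D i) :: 'k nsym)"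
proof -
  let ?X = "\<lambda>i. chromatic_nsym (lab i) (D i) :: 'k nsym"
  have lab: "inj_on (lab i) (pverts (D i))" if "i \<ge> 1" for i
    using labeling[OF that] by (rule bij_betw_imp_inj_on)
  have nonempty: "pverts (D i) \<noteq> {}" and fin: "finite (pverts (D i))" if "i \<ge> 1" for i
    using order[OF that] that card.infinite by fastforce+
  have graded: "?X i \<in> graded i 1" if "i \<ge> 1" for i
    using chromatic_nsym_graded[OF fin nonempty lab, OF that that that] order[OF that] by simp
  have leading: "Poly_Mapping.lookup (?X i) (Word [i]) \<noteq> 0" if i: "i \<ge> 1" for i
  proof -
    interpret pair_digraph "D i" using digraph[OF i] .
    have arcs: "parcs (D i) \<subseteq> pverts (D i) \<times> pverts (D i)"
      using in_arcsD1 in_arcsD2 by fastforce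
    \<comment> \<open>For the full arc set, \<open>spanning_sym\<close> is the symmetrization of
      \<open>D i\<close> itself, whose strong connectedness is the connectedness hypothesis.\<close>
    have "connects fst snd (pverts (D i)) (parcs (D i))"
      using conn[OF i] unfolding connects_iff_reachable[OF arcs]
      by (simp add: connected_def strongly_connected_def mk_symmetric_def)
    then have "connected_sum fst snd (pverts (D i)) (parcs (D i)) \<noteq> 0"
      using connected_sum_sign[of "parcs (D i)" "pverts (D i)" fst snd] nonempty[OF i] arcs no_loops
      by fastforce
    moreover have "Poly_Mapping.lookup (?X i) (Word [i]) =
        of_nat i * of_int (connected_sum fst snd (pverts (D i)) (parcs (D i)))"
      using lookup_chromatic_nsym[OF digraph nonempty lab, OF i i i] unfolding order[OF i] .
    \<comment> \<open>Characteristic 0 keeps both nonzero integers nonzero in the field.\<close>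
    ultimately show ?thesis using i by simp
  qed
  show ?thesis
    using nc_subalgebra_hull_eq_NSym[of ?X] nc_independent_of_leading[of ?X] graded leading
    by blast
qed

end
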